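(* Let $G$ be a $2$-connected $[4,2]$-graph of order at least $8$. Then $G$ is not uniquely hamiltonian, i.e., $G$ does not contain exactly one Hamilton cycle.
   Context: All graphs are finite and simple. For a positive integer $s$ and a nonnegative integer $t$, a graph $G$ of order at least $s$ is called an $[s,t]$-graph if every induced subgraph of $G$ on $s$ vertices has at least $t$ edges. A graph is uniquely hamiltonian if it contains exactly one Hamilton cycle. *)

theory Defs
  imports "Graph_Theory.Digraph_Component"
begin

text \<open>
  A finite simple graph is a \<^locale>\<open>pair_graph\<close>: a finite loopless digraph with a symmetric set of
  ordered pairs as arcs. One undirected edge is thus a pair of opposite arcs, and edges are
  counted as two-element vertex sets.
\<close>

definition edges :: "('a, 'b) pre_digraph \<Rightarrow> 'a set set" where
  "edges G = (\<lambda>e. {tail G e, head G e}) ` arcs G"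

definition st_graph :: "nat \<Rightarrow> nat \<Rightarrow> ('a, 'b) pre_digraph \<Rightarrow> bool" where
  "st_graph s t G \<longleftrightarrow> 0 < s \<and> s \<le> card (verts G) \<and>
     (\<forall>S \<subseteq> verts G. card S = s \<longrightarrow> t \<le> card (edges (G \<restriction> S)))"

definition k_connected :: "nat \<Rightarrow> ('a, 'b) pre_digraph \<Rightarrow> bool" where
  "k_connected k G \<longleftrightarrow> k < card (verts G) \<and>
     (\<forall>X \<subseteq> verts G. card X < k \<longrightarrow> Digraph_Component.connected (G \<restriction> (verts G - X)))"

text \<open>
  A cycle of a graph is a subgraph, without orientation or starting point. The cycles of
  \<^const>\<open>pre_digraph.cycle\<close> are directed closed arc walks of any positive length (in particular, an
  edge traversed back and forth is one), whence the length bound and the symmetric closure.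
\<close>

definition cycle_graph :: "'a pair_pre_digraph \<Rightarrow> bool" where
  "cycle_graph C \<longleftrightarrow> (\<exists>p. pre_digraph.cycle (with_proj C) p \<and> 3 \<le> length p \<and>
     pverts C = fst ` set p \<and> parcs C = set p \<union> (set p)\<inverse>)"

definition hamilton_cycle :: "'a pair_pre_digraph \<Rightarrow> 'a pair_pre_digraph \<Rightarrow> bool" where
  "hamilton_cycle G C \<longleftrightarrow> cycle_graph C \<and> spanning (with_proj C) (with_proj G)"

definition uniquely_hamiltonian :: "'a pair_pre_digraph \<Rightarrow> bool" where
  "uniquely_hamiltonian G \<longleftrightarrow> (\<exists>!C. hamilton_cycle G C)"

end

theory Submission
  imports Defs
begin

text \<open>
  Suppose that the Hamilton cycle \<open>v\<^sub>0 v\<^sub>1 \<dots>\<close> is unique. Then any eight consecutive vertices span a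
  subgraph whose only Hamilton path with the same two ends is the segment of the cycle. Since every
  four vertices span two edges, a finite case analysis shows that the second and the sixth vertex of
  the segment are not adjacent. Applied to all segments, this says that no two vertices at distance
  4 along the cycle are adjacent, and with this a second such case analysis shows the same for
  distance 2. Now \<open>v\<^sub>0, v\<^sub>2, v\<^sub>4, v\<^sub>6\<close> span at most the edge \<open>v\<^sub>0 v\<^sub>6\<close>, a contradiction.
\<close>

section \<open>Cycle graphs as cyclic vertex lists\<close>

definition cycle_of :: "'a list \<Rightarrow> 'a pair_pre_digraph" where
  "cycle_of vs = \<lparr>pverts = set vs, parcs = set (zip vs (rotate1 vs)) \<union> (set (zip vs (rotate1 vs)))\<inverse>\<rparr>"

lemma pcas_zip: "pcas x (zip (x # xs) (xs @ [v])) v"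
  by (induction xs arbitrary: x) auto

lemma pawalk_verts_zip: "pawalk_verts x (zip (x # xs) (xs @ [v])) = x # xs @ [v]"
  by (induction xs arbitrary: x) auto

text \<open>Each head is the next tail, so a walk is determined by its tails; this turns the arc
  walk behind \<open>cycle_graph\<close> into a vertex list.\<close>

lemma pcas_imp_zip:
  assumes "pcas u p v"
  shows "p = zip (map fst p) (tl (map fst p) @ [v])" "pawalk_verts u p = map fst p @ [v]"
    "p \<noteq> [] \<Longrightarrow> fst (hd p) = u"
  using assms
proof (induction p arbitrary: u)
  case (Cons e p)
  {
    case 1
    then show ?case using Cons.IH(1,3)[of "snd e"] by (cases p) (auto simp: prod_eq_iff)
  next
    case 2
    then show ?case using Cons.IH(2) by auto
  next
    case 3
    then show ?case by simp
  }
qed auto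

lemma cycle_graph_cycle_of:
  assumes "distinct vs" "3 \<le> length vs"
  shows "cycle_graph (cycle_of vs)"
proof -
  obtain x xs where vs: "vs = x # xs" using assms(2) by (cases vs) auto
  let ?p = "zip vs (rotate1 vs)"
  have "pre_digraph.cycle (with_proj (cycle_of vs)) ?p"
    using assms pcas_zip[of x xs x] pawalk_verts_zip[of x xs x]
    unfolding pre_digraph.cycle_def pre_digraph.awalk_def awalk_verts_with_proj_eq cas_with_proj_eq
    by (auto simp: vs cycle_of_def intro!: exI[of _ x])
  moreover have "map fst ?p = vs" by simp
  then have "fst ` set ?p = set vs" by (metis list.set_map)
  ultimately show ?thesis
    unfolding cycle_graph_def using assms(2)
    by (intro exI[of _ ?p]) (auto simp: cycle_of_def)
qed

lemma cycle_graphE: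
  assumes "cycle_graph C"
  obtains vs where "distinct vs" "3 \<le> length vs" "C = cycle_of vs"
proof -
  obtain p u where p: "3 \<le> length p" "pverts C = fst ` set p" "parcs C = set p \<union> (set p)\<inverse>"
    "pcas u p u" "distinct (tl (pawalk_verts u p))"
    using assms
    unfolding cycle_graph_def pre_digraph.cycle_def pre_digraph.awalk_def
      awalk_verts_with_proj_eq cas_with_proj_eq by blast
  define vs where "vs = map fst p"
  have ne: "vs \<noteq> []" "p \<noteq> []" using p(1) by (auto simp: vs_def)
  have "hd vs = u" using pcas_imp_zip(3)[OF p(4) ne(2)] ne by (simp add: vs_def hd_map)
  then have zip: "p = zip vs (rotate1 vs)" "pawalk_verts u p = vs @ [hd vs]"
    using pcas_imp_zip(1,2)[OF p(4)] ne by (simp_all add: vs_def rotate1_hd_tl)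
  have "distinct (tl vs @ [hd vs])" using p(5) zip(2) ne by simp
  then have "distinct vs" by (cases vs) auto
  moreover have "C = cycle_of vs"
    using p(2,3) zip(1)[symmetric] by (cases C) (simp add: cycle_of_def vs_def)
  ultimately show thesis using that p(1) by (simp add: vs_def)
qed

lemma cycle_of_neighbour:
  assumes "distinct vs" "i < length vs" "(vs ! i, y) \<in> parcs (cycle_of vs)"
  obtains "y = vs ! (Suc i mod length vs)"
    | j where "j < length vs" "i = Suc j mod length vs" "y = vs ! j"
proof -
  have "(vs ! i, y) \<in> set (zip vs (rotate1 vs)) \<or> (y, vs ! i) \<in> set (zip vs (rotate1 vs))"
    using assms(3) by (auto simp: cycle_of_def)
  then obtain j where j: "j < length vs"
    "vs ! i = vs ! j \<and> y = vs ! (Suc j mod length vs) \<or> y = vs ! j \<and> vs ! i = vs ! (Suc j mod length vs)"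
    by (auto simp: in_set_zip nth_rotate1)
  then have "i = j \<and> y = vs ! (Suc j mod length vs) \<or> y = vs ! j \<and> i = Suc j mod length vs"
    using assms(1,2) by (metis mod_less_divisor less_nat_zero_code neq0_conv nth_eq_iff_index_eq)
  then show thesis using that j(1) by blast
qed

text \<open>A common first and a common last vertex fix both the starting point and the orientation.\<close>

lemma cycle_of_inj:
  assumes "distinct us" "distinct ws" "3 \<le> length us" "length us = length ws"
    and "hd us = hd ws" "last us = last ws" "cycle_of us = cycle_of ws"
  shows "us = ws"
proof (rule nth_equalityI)
  fix i assume "i < length us"
  then show "us ! i = ws ! i"
  proof (induction i rule: less_induct)
    case (less i)
    show ?case
    proof (cases i)
      case 0
      then show ?thesis using assms(3-5) by (metis hd_conv_nth list.size(3) not_numeral_le_zero)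
    next
      case (Suc k)
      have eq: "us ! j = ws ! j" if "j \<le> k" for j using less Suc that by simp
      have k: "Suc k < length us" using less.prems Suc by simp
      then have "(ws ! k, ws ! Suc k) \<in> set (zip ws (rotate1 ws))"
        using assms(4) by (auto simp: in_set_zip nth_rotate1)
      then have "(us ! k, ws ! Suc k) \<in> parcs (cycle_of us)"
        using assms(7) eq by (simp add: cycle_of_def)
      then show ?thesis
      proof (rule cycle_of_neighbour[OF assms(1) Suc_lessD[OF k]])
        assume "ws ! Suc k = us ! (Suc k mod length us)"
        then show ?thesis using k Suc by simp
      next
        fix j assume 2: "j < length us" "k = Suc j mod length us" "ws ! Suc k = us ! j"
        show ?thesis
        proof (cases "Suc j = length us")
          \<comment> \<open>Wrapping around happens only at \<open>k = 0\<close>; then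
            \<open>ws ! 1\<close> would be the last entry of a list of length at least 3. Otherwise,
            stepping back repeats the earlier entry \<open>ws ! j\<close>.\<close>
          case True
          then have "ws ! Suc k = last ws"
            using 2 assms(3,6) by (metis diff_Suc_1 last_conv_nth list.size(3) not_numeral_le_zero)
          then have "ws ! Suc k = ws ! (length ws - 1)" "k = 0"
            using 2 True assms(3,4) last_conv_nth[of ws] by fastforce+
          then show ?thesis using assms(2-4) k by (simp add: nth_eq_iff_index_eq)
        next
          case False
          then have "k = Suc j" using 2 by simp
          then have "ws ! Suc k = ws ! j" using 2 eq[of j] by simp
          then show ?thesis using assms(2,4) k \<open>k = Suc j\<close> by (simp add: nth_eq_iff_index_eq)
        qed
      qed
    qed
  qed
qed (fact assms(4))

section \<open>Hamilton lists and their uniqueness\<close>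

lemma successively_closed_conv_zip:
  assumes "vs \<noteq> []"
  shows "successively P (vs @ [hd vs]) \<longleftrightarrow> (\<forall>(x, y) \<in> set (zip vs (rotate1 vs)). P x y)"
proof -
  have "successively P (x # xs @ [v]) \<longleftrightarrow> (\<forall>(a, b) \<in> set (zip (x # xs) (xs @ [v])). P a b)" for x xs v
    by (induction xs arbitrary: x) auto
  then show ?thesis using assms by (cases vs) auto
qed

definition hamilton_list :: "('a \<Rightarrow> 'a \<Rightarrow> bool) \<Rightarrow> 'a set \<Rightarrow> 'a list \<Rightarrow> bool" where
  "hamilton_list E V vs \<longleftrightarrow> distinct vs \<and> set vs = V \<and> successively E (vs @ [hd vs])"

text \<open>Rotating by \<open>length vs - k + i\<close> puts \<open>vs ! i\<close> at position
  \<open>k\<close>, even for \<open>i < k\<close>, where the window starts before the head of the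
  list.\<close>

lemma nth_rotate_minus:
  assumes "k + j < length vs" "i + j < length vs"
  shows "rotate (length vs - k + i) vs ! (k + j) = vs ! (i + j)"
proof -
  have "length vs - k + i + (k + j) = i + j + length vs" using assms(1) by simp
  then show ?thesis using assms by (metis nth_rotate mod_add_self2 mod_less)
qed

text \<open>\<open>two_edges\<close> omits the pair \<open>y\<close>, \<open>z\<close>: it may carry
  one of the two edges, but not both. In \<open>unique\<close>, the common ends exclude rotations
  and reversals, under which one cycle has several lists.\<close>

locale unique_hamilton_list =
  fixes E :: "'a \<Rightarrow> 'a \<Rightarrow> bool" and V :: "'a set"
  assumes sym: "E x y \<longleftrightarrow> E y x"
    and two_edges: "\<lbrakk>distinct [w, x, y, z]; {w, x, y, z} \<subseteq> V\<rbrakk>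
      \<Longrightarrow> E w x \<or> E w y \<or> E w z \<or> E x y \<or> E x z"
    and unique: "\<lbrakk>hamilton_list E V us; hamilton_list E V ws; hd us = hd ws; last us = last ws\<rbrakk>
      \<Longrightarrow> us = ws"
begin

abbreviation ham :: "'a list \<Rightarrow> bool" where
  "ham \<equiv> hamilton_list E V"

lemma ham_rotate: "ham vs \<Longrightarrow> ham (rotate k vs)"
proof (induction k)
  case (Suc k)
  have "ham (rotate1 us)" if "ham us" for us
  proof (cases us rule: remdups_adj.cases)
    case (3 x y ys)
    then have E: "E x y" "successively E (y # ys @ [x])"
      using that by (simp_all add: hamilton_list_def)
    have "successively E ((y # ys @ [x]) @ [y])"
      using E by (subst successively_append_iff) simp
    then show ?thesis using that 3 by (auto simp: hamilton_list_def)
  qed (use that in \<open>simp_all add: hamilton_list_def\<close>)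
  then show ?case using Suc by simp
qed simp

text \<open>A rearranged segment with the same ends still attaches to \<open>zs\<close> and still
  closes up, so it would give a second Hamilton list with the same first and last vertex.\<close>

lemma window_unique:
  assumes "ham (xs @ zs)" "xs \<noteq> []" "mset ys = mset xs" "hd ys = hd xs" "last ys = last xs"
    and "successively E ys"
  shows "ys = xs"
proof -
  have ys: "set ys = set xs" "distinct ys \<longleftrightarrow> distinct xs" "ys \<noteq> []"
    using assms(2,3) by (metis mset_eq_setD, metis mset_eq_imp_distinct_iff, auto)
  then have "ham (ys @ zs)"
    using assms unfolding hamilton_list_def by (auto simp: successively_append_iff)
  then have "ys @ zs = xs @ zs"
    using unique[of "ys @ zs" "xs @ zs"] assms ys(3) by (simp add: last_append)
  then show ?thesis by simp
qed

lemma window_cases: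
  assumes "ham vs" "8 \<le> length vs"
  obtains a b c d e f g h zs where "vs = [a, b, c, d, e, f, g, h] @ zs"
proof -
  have "length (take 8 vs) = Suc (Suc (Suc (Suc (Suc (Suc (Suc (Suc 0)))))))" using assms by simp
  then obtain a b c d e f g h where "take 8 vs = [a, b, c, d, e, f, g, h]"
    by (auto simp only: length_Suc_conv length_0_conv)
  then show thesis using that append_take_drop_id[of 8 vs] by metis
qed

end

section \<open>Excluded chords in a window of eight vertices\<close>

locale hamilton_window = unique_hamilton_list E V
  for E :: "'a \<Rightarrow> 'a \<Rightarrow> bool" and V +
  fixes a b c d e f g h :: 'a and zs :: "'a list"
  assumes window: "ham ([a, b, c, d, e, f, g, h] @ zs)"
begin

text \<open>The reversed list gives the simplifier every inequality in the other
  orientation.\<close>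

lemma window_distinct: "distinct [a, b, c, d, e, f, g, h]" "distinct [h, g, f, e, d, c, b, a]"
  and window_subset: "a \<in> V" "b \<in> V" "c \<in> V" "d \<in> V" "e \<in> V" "f \<in> V" "g \<in> V" "h \<in> V"
  and path: "E a b" "E b c" "E c d" "E d e" "E e f" "E f g" "E g h"
  using window by (auto simp: hamilton_list_def)

lemmas neqs = window_distinct[simplified]

lemma detour:
  assumes "mset ys = mset [a, b, c, d, e, f, g, h]" "hd ys = a" "last ys = h"
    and "ys \<noteq> [a, b, c, d, e, f, g, h]"
  shows "\<not> successively E ys"
  using window_unique[OF window, of ys] assms by auto

text \<open>
  After simplification, each instance of \<open>detour\<close> in the next two proofs says that the chords which
  it uses are not all present.
\<close>

lemma not_adj_b_f: "\<not> E b f"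
proof
  assume "E b f"
  note [simp] = sym path neqs window_subset
  note moves =
    detour[of "[a, c, b, d, e, f, g, h]"]
    detour[of "[a, e, d, c, b, f, g, h]"]
    detour[of "[a, g, f, e, d, c, b, h]"]
    detour[of "[a, b, d, c, e, f, g, h]"]
    detour[of "[a, b, f, e, d, c, g, h]"]
    detour[of "[a, b, c, e, d, f, g, h]"]
    detour[of "[a, b, c, d, f, e, g, h]"]
    detour[of "[a, b, c, d, e, g, f, h]"]
    detour[of "[a, c, d, e, b, f, g, h]"]
    detour[of "[a, c, d, e, f, b, g, h]"]
    detour[of "[a, c, b, f, e, d, g, h]"]
    detour[of "[a, d, e, c, b, f, g, h]"]
    detour[of "[a, f, b, c, d, e, g, h]"]
    detour[of "[a, g, b, c, d, e, f, h]"]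
    detour[of "[a, b, f, e, c, d, g, h]"]
    detour[of "[a, b, f, c, d, e, g, h]"]
    detour[of "[a, b, f, g, e, d, c, h]"]
    detour[of "[a, c, b, f, g, e, d, h]"]
    detour[of "[a, g, f, b, c, e, d, h]"]
  \<comment> \<open>\<open>E b f\<close> excludes \<open>E a e\<close> and \<open>E c g\<close> at
    once, so \<open>c e a g\<close> leave \<open>E a c\<close>, \<open>E c e\<close> or
    \<open>E e g\<close>; the other sets refute each. In those other sets the last two vertices are
    known to be adjacent, so a further edge is forced.\<close>
  note four_sets =
    two_edges[of a g c d]
    two_edges[of b d g h]
    two_edges[of f h c d]
    two_edges[of b g d e]
    two_edges[of d h b f]
    two_edges[of c e a g]
    two_edges[of a c e f]
  show False
    using \<open>E b f\<close> moves[simplified] four_sets[simplified]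
    by sat
qed

lemma not_adj_c_e:
  assumes "\<not> E a e" "\<not> E b f" "\<not> E c g" "\<not> E d h"
  shows "\<not> E c e"
proof
  assume "E c e"
  note [simp] = sym path neqs window_subset
  note moves =
    detour[of "[a, d, c, b, e, f, g, h]"]
    detour[of "[a, g, f, e, d, c, b, h]"]
    detour[of "[a, b, d, c, e, f, g, h]"]
    detour[of "[a, b, c, e, d, f, g, h]"]
    detour[of "[a, b, c, d, e, g, f, h]"]
    detour[of "[a, c, d, e, f, g, b, h]"]
    detour[of "[a, b, c, e, d, g, f, h]"]
  \<comment> \<open>\<open>E c e\<close> excludes \<open>E b d\<close> and \<open>E d f\<close>, so
    \<open>b d f h\<close> carry exactly \<open>E b h\<close> and \<open>E f h\<close>; the set
    occurs twice because each omitted pair yields one edge. These exclude \<open>E a g\<close>,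
    \<open>E e g\<close> and \<open>E d g\<close>. Then \<open>a g c e\<close> force
    \<open>E a c\<close>, which excludes \<open>E b g\<close>; \<open>b g d e\<close> force
    \<open>E b e\<close>, which excludes \<open>E a d\<close>; and \<open>d g a b\<close> are left
    with \<open>E a b\<close> alone.\<close>
  note four_sets =
    two_edges[of d f b h]
    two_edges[of b g d e]
    two_edges[of a g c e]
    two_edges[of b d f h]
    two_edges[of d g a b]
  show False
    using \<open>E c e\<close> assms moves[simplified] four_sets[simplified]
    by sat
qed

end

section \<open>Transfer to the whole cycle by rotation\<close>

context unique_hamilton_list
begin

lemma not_adj_nth:
  assumes "ham vs" "8 \<le> length vs"
  shows not_adj_1_5: "\<not> E (vs ! 1) (vs ! 5)"
    and not_adj_2_4: "\<lbrakk>\<not> E (vs ! 0) (vs ! 4); \<not> E (vs ! 1) (vs ! 5); \<not> E (vs ! 2) (vs ! 6); \<not> E (vs ! 3) (vs ! 7)\<rbrakk>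
      \<Longrightarrow> \<not> E (vs ! 2) (vs ! 4)"
proof -
  from assms obtain a b c d e f g h zs where vs: "vs = [a, b, c, d, e, f, g, h] @ zs"
    by (rule window_cases)
  interpret hamilton_window E V a b c d e f g h zs
    using assms(1) vs by unfold_locales simp
  show "\<not> E (vs ! 1) (vs ! 5)"
    and "\<lbrakk>\<not> E (vs ! 0) (vs ! 4); \<not> E (vs ! 1) (vs ! 5); \<not> E (vs ! 2) (vs ! 6); \<not> E (vs ! 3) (vs ! 7)\<rbrakk>
      \<Longrightarrow> \<not> E (vs ! 2) (vs ! 4)"
    using not_adj_b_f not_adj_c_e by (simp_all add: vs)
qed

lemma not_adj_distance_4:
  assumes "ham vs" "8 \<le> length vs" "i + 4 < length vs"
  shows "\<not> E (vs ! i) (vs ! (i + 4))"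
proof -
  \<comment> \<open>With \<open>vs ! i\<close> at position 1, the chord joins the second and the
    sixth vertex of a window.\<close>
  let ?ws = "rotate (length vs - 1 + i) vs"
  have "?ws ! 1 = vs ! i" "?ws ! 5 = vs ! (i + 4)"
    using nth_rotate_minus[of 1 0 vs i] nth_rotate_minus[of 1 4 vs i] assms(2,3) by simp_all
  then show ?thesis
    using not_adj_1_5[of ?ws] ham_rotate[OF assms(1)] assms(2) by simp
qed

lemma not_adj_distance_2:
  assumes "ham vs" "8 \<le> length vs" "i + 2 < length vs"
  shows "\<not> E (vs ! i) (vs ! (i + 2))"
proof -
  let ?ws = "rotate (length vs - 2 + i) vs"
  have "?ws ! 2 = vs ! i" "?ws ! 4 = vs ! (i + 2)"
    using nth_rotate_minus[of 2 0 vs i] nth_rotate_minus[of 2 2 vs i] assms(2,3) by simp_all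
  moreover have ws: "ham ?ws" "8 \<le> length ?ws"
    using ham_rotate[OF assms(1)] assms(2) by simp_all
  \<comment> \<open>These are the four nonadjacency hypotheses of
    \<open>not_adj_2_4\<close>.\<close>
  have "\<not> E (?ws ! j) (?ws ! (j + 4))" if "j < 4" for j
    using not_adj_distance_4[OF ws] that ws(2) by simp
  from this[of 0] this[of 1] this[of 2] this[of 3] have "\<not> E (?ws ! 2) (?ws ! 4)"
    using not_adj_2_4[OF ws] by simp
  ultimately show ?thesis by simp
qed

lemma length_ham_less_8:
  assumes "ham vs"
  shows "length vs < 8"
proof (rule ccontr)
  assume "\<not> length vs < 8"
  then have len: "8 \<le> length vs" "vs \<noteq> []" by auto
  \<comment> \<open>This order makes \<open>vs ! 0\<close>, \<open>vs ! 6\<close>, at distance 6,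
    the pair that \<open>two_edges\<close> omits.\<close>
  have "distinct [vs ! 2, vs ! 4, vs ! 0, vs ! 6]" "{vs ! 2, vs ! 4, vs ! 0, vs ! 6} \<subseteq> V"
    using assms len by (auto simp: hamilton_list_def nth_eq_iff_index_eq)
  from two_edges[OF this] show False
    using not_adj_distance_4[OF assms len(1), of 0] not_adj_distance_4[OF assms len(1), of 2]
      not_adj_distance_2[OF assms len(1), of 0] not_adj_distance_2[OF assms len(1), of 2]
      not_adj_distance_2[OF assms len(1), of 4] len sym by (simp add: eval_nat_numeral)
qed

end

section \<open>From Hamilton lists back to graphs\<close>

lemma hamilton_cycle_iff_hamilton_list:
  assumes "pair_graph G"
  shows "hamilton_cycle G C \<longleftrightarrow>
    (\<exists>vs. 3 \<le> length vs \<and> hamilton_list (\<lambda>x y. (x, y) \<in> parcs G) (pverts G) vs \<and> C = cycle_of vs)"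
proof -
  interpret pair_graph G by fact
  have sub: "parcs (cycle_of vs) \<subseteq> parcs G \<longleftrightarrow> successively (\<lambda>x y. (x, y) \<in> parcs G) (vs @ [hd vs])"
    if "3 \<le> length vs" for vs
  proof -
    \<comment> \<open>Arcs of \<open>G\<close> are symmetric, so the converse in
      \<open>cycle_of\<close> adds no condition.\<close>
    have "parcs (cycle_of vs) \<subseteq> parcs G \<longleftrightarrow> set (zip vs (rotate1 vs)) \<subseteq> parcs G"
      using arcs_symmetric by (auto simp: cycle_of_def)
    then show ?thesis
      using that by (subst successively_closed_conv_zip) auto
  qed
  have wf: "pair_wf_digraph (cycle_of vs)" for vs :: "'a list"
    by unfold_locales (auto simp: cycle_of_def dest: set_zip_leftD set_zip_rightD)
  have span: "spanning (with_proj (cycle_of vs)) (with_proj G) \<longleftrightarrow>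
      set vs = pverts G \<and> parcs (cycle_of vs) \<subseteq> parcs G" for vs
    using wf[of vs] pair_wf_digraph
    by (auto simp: spanning_def subgraph_def wf_digraph_wp_iff) (auto simp: cycle_of_def)
  show ?thesis
  proof
    assume C: "hamilton_cycle G C"
    then obtain vs where vs: "distinct vs" "3 \<le> length vs" "C = cycle_of vs"
      by (auto simp: hamilton_cycle_def elim: cycle_graphE)
    then have "hamilton_list (\<lambda>x y. (x, y) \<in> parcs G) (pverts G) vs"
      using C span[of vs] sub[OF vs(2)] by (simp add: hamilton_cycle_def hamilton_list_def)
    then show "\<exists>vs. 3 \<le> length vs \<and> hamilton_list (\<lambda>x y. (x, y) \<in> parcs G) (pverts G) vs \<and> C = cycle_of vs"
      using vs by blast
  next
    assume "\<exists>vs. 3 \<le> length vs \<and> hamilton_list (\<lambda>x y. (x, y) \<in> parcs G) (pverts G) vs \<and> C = cycle_of vs"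
    then obtain vs where vs: "3 \<le> length vs" "C = cycle_of vs"
      "distinct vs" "set vs = pverts G" "successively (\<lambda>x y. (x, y) \<in> parcs G) (vs @ [hd vs])"
      by (auto simp: hamilton_list_def)
    then show "hamilton_cycle G C"
      using cycle_graph_cycle_of[OF vs(3,1)] span[of vs] sub[OF vs(1)] by (simp add: hamilton_cycle_def)
  qed
qed

text \<open>Opposite arcs give one element of \<open>edges\<close>, so outside the five pairs only
  \<open>{y, z}\<close> can remain.\<close>

lemma st_graph_4_2_edges:
  assumes "st_graph 4 2 (with_proj G)" "distinct [w, x, y, z]" "{w, x, y, z} \<subseteq> pverts G"
    and "pair_graph G"
  shows "(w, x) \<in> parcs G \<or> (w, y) \<in> parcs G \<or> (w, z) \<in> parcs G \<or> (x, y) \<in> parcs G \<or> (x, z) \<in> parcs G"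
proof (rule ccontr)
  interpret pair_graph G by fact
  let ?S = "{w, x, y, z}"
  assume none: "\<not> ?thesis"
  have "edges (with_proj G \<restriction> ?S) \<subseteq> {{y, z}}"
  proof
    fix A assume "A \<in> edges (with_proj G \<restriction> ?S)"
    then obtain p q where pq: "(p, q) \<in> parcs G" "p \<in> ?S" "q \<in> ?S" "A = {p, q}"
      by (auto simp: edges_def induce_subgraph_def)
    have "(q, p) \<in> parcs G" "p \<noteq> q" using pq(1) arcs_symmetric no_loops' by blast+
    then have "{p, q} = {y, z}" using none pq(1-3) by auto
    then show "A \<in> {{y, z}}" using pq(4) by simp
  qed
  then have "card (edges (with_proj G \<restriction> ?S)) \<le> 1"
    using card_mono[of "{{y, z}}"] by simp
  moreover have "card ?S = 4" using assms(2) by simp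
  then have "2 \<le> card (edges (with_proj G \<restriction> ?S))"
    using assms(1,3) unfolding st_graph_def with_proj_simps by blast
  ultimately show False by linarith
qed

theorem theorem12:
  fixes G :: "'a pair_pre_digraph"
  assumes "pair_graph G"
    and "k_connected 2 (with_proj G)"
    and "st_graph 4 2 (with_proj G)"
    and "8 \<le> card (pverts G)"
  shows "\<not> uniquely_hamiltonian G"
proof
  interpret pair_graph G by fact
  let ?E = "\<lambda>x y. (x, y) \<in> parcs G"
  assume "uniquely_hamiltonian G"
  then obtain C where C: "hamilton_cycle G C" "\<And>D. hamilton_cycle G D \<Longrightarrow> D = C"
    by (auto simp: uniquely_hamiltonian_def)
  note iff = hamilton_cycle_iff_hamilton_list[OF assms(1)]
  have len: "length vs = card (pverts G)" if "hamilton_list ?E (pverts G) vs" for vs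
    using that distinct_card[of vs] by (simp add: hamilton_list_def)
  interpret unique_hamilton_list ?E "pverts G"
  proof
    show "?E x y \<longleftrightarrow> ?E y x" for x y using arcs_symmetric by blast
    show "?E w x \<or> ?E w y \<or> ?E w z \<or> ?E x y \<or> ?E x z"
      if "distinct [w, x, y, z]" "{w, x, y, z} \<subseteq> pverts G" for w x y z
      using st_graph_4_2_edges[OF assms(3) that assms(1)] .
    show "us = ws"
      if "hamilton_list ?E (pverts G) us" "hamilton_list ?E (pverts G) ws" "hd us = hd ws" "last us = last ws"
      for us ws
    proof (rule cycle_of_inj)
      \<comment> \<open>Both lists trace the unique cycle; the order of at least 8 gives the length
        3 that \<open>iff\<close> asks for.\<close>
      have "cycle_of us = C" "cycle_of ws = C"
        using C(2)[of "cycle_of us"] C(2)[of "cycle_of ws"] iff[of "cycle_of us"] iff[of "cycle_of ws"]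
          that(1,2) len[OF that(1)] len[OF that(2)] assms(4) by force+
      then show "cycle_of us = cycle_of ws" by simp
    qed (use that len assms(4) in \<open>auto simp: hamilton_list_def\<close>)
  qed
  obtain vs where "hamilton_list ?E (pverts G) vs" using C(1) iff by blast
  then show False using length_ham_less_8[of vs] len assms(4) by simp
qed

end
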